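(* Let $r\ge 1$ and $k\ge 1$ be integers, and let $T$ be an integer sequence satisfying a homogeneous meta-Fibonacci recursion $$T(n)=\sum_{p=1}^{k} T\big(S_p(n,T_{<n})\big)\qquad (n>r)$$ with $r$ given initial values $T(1),\dots,T(r)$, where each spot function $S_p(n)=S_p(n,T_{<n})$ depends only on $n$ and the values $T(j)$, $j<n$, and satisfies $1\le S_p(n)<n$ for all $n>r$. Fix $p\in\{1,\dots,k\}$ and define the generation sequence $M_p$ by $M_p(n)=1$ for $1\le n\le r$ and $M_p(n)=M_p(S_p(n))+1$ for $n>r$. If the spot sequence $(S_p(n))_{n>r}$ is slow-growing, then $M_p$ is slow-growing.
   Context: A sequence $(x_n)$ is called slow-growing (or slow) if it is monotonically nondecreasing with $x_{n+1}-x_n\in\{0,1\}$ for all $n$ in its domain. $M_p$ is called the generation sequence of $T$ based on spot $p$. *)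

theory Defs
  imports Main
begin

text \<open>
  Sequences indexed by positive integers are functions on \<open>nat\<close>; the value at \<open>0\<close> is never used.
  A spot function receives \<open>p\<close>, \<open>n\<close> and the history \<open>[T 1, \<dots>, T (n - 1)]\<close> as a list, so that
  it depends on nothing but \<open>n\<close> and the values \<open>T j\<close> with \<open>1 \<le> j < n\<close>.
\<close>

type_synonym spot_funs = "nat \<Rightarrow> nat \<Rightarrow> int list \<Rightarrow> nat"

definition slow_growing_on :: "nat set \<Rightarrow> (nat \<Rightarrow> int) \<Rightarrow> bool" where
  "slow_growing_on D x \<longleftrightarrow>
     mono_on D x \<and> (\<forall>n. n \<in> D \<and> n + 1 \<in> D \<longrightarrow> x (n + 1) - x n \<in> {0, 1})"

definition spot_seq :: "spot_funs \<Rightarrow> (nat \<Rightarrow> int) \<Rightarrow> nat \<Rightarrow> nat \<Rightarrow> nat" where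
  "spot_seq S T p n = S p n (map T [1..<n])"

definition meta_fibonacci :: "nat \<Rightarrow> nat \<Rightarrow> spot_funs \<Rightarrow> (nat \<Rightarrow> int) \<Rightarrow> bool" where
  "meta_fibonacci r k S T \<longleftrightarrow>
     (\<forall>n>r. (\<forall>p\<in>{1..k}. 1 \<le> spot_seq S T p n \<and> spot_seq S T p n < n) \<and>
            T n = (\<Sum>p=1..k. T (spot_seq S T p n)))"

definition generation_seq :: "nat \<Rightarrow> (nat \<Rightarrow> nat) \<Rightarrow> (nat \<Rightarrow> int) \<Rightarrow> bool" where
  "generation_seq r s M \<longleftrightarrow>
     (\<forall>n\<in>{1..r}. M n = 1) \<and> (\<forall>n>r. M n = M (s n) + 1)"

lemma generation_seq_exists:
  assumes "\<And>n. n > r \<Longrightarrow> 1 \<le> s n \<and> s n < n"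
  shows "\<exists>M. generation_seq r s M"
proof -
  define F where "F = (\<lambda>(M :: nat \<Rightarrow> int) n. if n \<le> r then 1 else M (s n) + 1)"
  have "adm_wf less_than F"
    using assms by (auto simp: adm_wf_def F_def)
  then have "wfrec less_than F n = F (wfrec less_than F) n" for n
    by (metis wfrec_fixpoint wf_less_than)
  then have "generation_seq r s (wfrec less_than F)"
    unfolding generation_seq_def by (metis F_def atLeastAtMost_iff leD)
  then show ?thesis by blast
qed

lemma generation_seq_unique:
  assumes "\<And>n. n > r \<Longrightarrow> 1 \<le> s n \<and> s n < n"
    and "generation_seq r s M" "generation_seq r s M'" "1 \<le> n"
  shows "M n = M' n"
  using \<open>1 \<le> n\<close>
proof (induction n rule: less_induct)
  case (less n)
  show ?case
  proof (cases "n \<le> r")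
    case True
    then show ?thesis using less.prems assms(2,3) by (simp add: generation_seq_def)
  next
    case False
    then have "n > r" by simp
    then have "M (s n) = M' (s n)" using less.IH assms(1) by blast
    then show ?thesis using \<open>n > r\<close> assms(2,3) by (simp add: generation_seq_def)
  qed
qed

end

theory Submission
  imports Defs
begin

text \<open>Past the initial block, slowness makes the spots of \<open>n\<close> and
  \<open>n + 1\<close> equal or consecutive. Hence \<open>M (n + 1) - M n\<close> is either 0 or the
  difference of \<open>M\<close> across the single step from \<open>s n\<close> to
  \<open>s n + 1\<close>, which lies strictly earlier. Strong induction on \<open>n\<close> carries
  this down to the initial block, where \<open>M\<close> is constantly 1.\<close>

text \<open>Since \<open>{a..}\<close> has no gaps, monotonicity follows by summing the nonnegative
  steps.\<close>

lemma slow_growing_on_atLeastI: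
  assumes "\<And>n. a \<le> n \<Longrightarrow> x (n + 1) - x n \<in> {0, 1}"
  shows "slow_growing_on {a..} x"
proof -
  have "x m \<le> x n" if "a \<le> m" "m \<le> n" for m n
    using \<open>m \<le> n\<close>
  proof (induction n rule: dec_induct)
    case (step n)
    then show ?case using assms[of n] \<open>a \<le> m\<close> by auto
  qed simp
  then show ?thesis
    using assms by (auto simp: slow_growing_on_def mono_on_def)
qed

lemma slow_growing_generation_seq:
  assumes "r \<ge> 1"
    and spot: "\<And>n. n > r \<Longrightarrow> 1 \<le> s n \<and> s n < n"
    and gen: "generation_seq r s M"
    and slow: "slow_growing_on {r<..} (\<lambda>n. int (s n))"
  shows "slow_growing_on {1..} M"
proof (rule slow_growing_on_atLeastI)
  have M_init: "M n = 1" if "1 \<le> n" "n \<le> r" for n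
    using gen that by (simp add: generation_seq_def)
  have M_rec: "M n = M (s n) + 1" if "n > r" for n
    using gen that by (simp add: generation_seq_def)
  fix n :: nat
  assume "1 \<le> n"
  then show "M (n + 1) - M n \<in> {0, 1}"
  proof (induction n rule: less_induct)
    case (less n)
    consider "n < r" | "n = r" | "n > r" by linarith
    then show ?case
    proof cases
      case 1
      then show ?thesis using M_init less.prems by simp
    next
      case 2
      \<comment> \<open>Slowness says nothing here, as \<open>s\<close> is constrained only beyond
        \<open>r\<close>. But \<open>s (r + 1)\<close> lies in \<open>{1..r}\<close>, so
        \<open>M (r + 1) = 2\<close> while \<open>M r = 1\<close>.\<close>
      then show ?thesis
        using M_init[of r] M_init[of "s (r + 1)"] M_rec[of "r + 1"] spot[of "r + 1"] \<open>r \<ge> 1\<close>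
        by simp
    next
      case 3
      then have "int (s (n + 1)) - int (s n) \<in> {0, 1}"
        using slow by (simp add: slow_growing_on_def)
      then have "s (n + 1) = s n \<or> s (n + 1) = s n + 1" by auto
      \<comment> \<open>The added 1s cancel; if the spot advances, the induction hypothesis applies
        at \<open>s n\<close>, because \<open>1 \<le> s n\<close> and
        \<open>s n < n\<close>.\<close>
      then show ?thesis
        using M_rec[of n] M_rec[of "n + 1"] less.IH[of "s n"] spot[of n] 3 by auto
    qed
  qed
qed

theorem theorem1:
  fixes r k p :: nat and S :: spot_funs and T M :: "nat \<Rightarrow> int"
  assumes "r \<ge> 1" and "k \<ge> 1"
    and "meta_fibonacci r k S T"
    and "p \<in> {1..k}"
    and "generation_seq r (spot_seq S T p) M"
    and "slow_growing_on {r<..} (\<lambda>n. int (spot_seq S T p n))"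
  shows "slow_growing_on {1..} M"
proof (rule slow_growing_generation_seq)
  show "1 \<le> spot_seq S T p n \<and> spot_seq S T p n < n" if "n > r" for n
    using assms(3,4) that unfolding meta_fibonacci_def by blast
qed (use assms in blast)+

end
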